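(* Consider a finite discounted MDP and its Q-value iteration $Q_{k+1}=F(Q_k)$, and let $e_k:=Q_k-Q^*\in\mathbb R^n$. Then, for each $k\ge0$, there exists a stochastic policy $\mu_k:\mathcal S\to\Delta_{|\mathcal A|}$ such that $$e_{k+1}=A_{\mu_k}e_k,$$ where $A_\mu:=\gamma P\Pi^\mu\in\mathbb R^{n\times n}$.
   Context: Finite discounted MDP: finite nonempty state set $\mathcal S$ and action set $\mathcal A$, transition probabilities $P(s'|s,a)$, expected one-step rewards $R(s,a)\in\mathbb R$, discount $\gamma\in(0,1)$. Put $n=|\mathcal S||\mathcal A|$ and identify functions $Q:\mathcal S\times\mathcal A\to\mathbb R$ with vectors in $\mathbb R^n$. $P$ also denotes the $n\times|\mathcal S|$ matrix with entry $P(s'|s,a)$ in row $(s,a)$, column $s'$. For a stochastic policy $\mu$ (a map $\mathcal S\to\Delta_{|\mathcal A|}$, the probability simplex over $\mathcal A$), $\Pi^\mu$ is the $|\mathcal S|\times n$ matrix with $(\Pi^\mu Q)(s)=\sum_a\mu(a|s)Q(s,a)$. Bellman operator: $(FQ)(s,a)=R(s,a)+\gamma\sum_{s'}P(s'|s,a)\max_{a'}Q(s',a')$. $Q^*$ is the optimal Q-function, the unique fixed point of $F$. *)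

theory Defs
  imports "HOL-Analysis.Analysis"
begin

definition prob_simplex :: "(real ^ 'n::finite) set" where
  "prob_simplex = {p. (\<forall>i. 0 \<le> p $ i) \<and> (\<Sum>i\<in>UNIV. p $ i) = 1}"

definition stochastic_policy :: "('s \<Rightarrow> real ^ 'a::finite) \<Rightarrow> bool" where
  "stochastic_policy \<mu> \<longleftrightarrow> (\<forall>s. \<mu> s \<in> prob_simplex)"

text \<open>
  A finite MDP has state type \<open>'s\<close> and action type \<open>'a\<close>; its transition matrix has entry
  \<open>P $ (s, a) $ s'\<close>, the probability of moving to \<open>s'\<close> from \<open>s\<close> under \<open>a\<close>. The reward
  \<open>R\<close> is an arbitrary vector and needs no condition.
\<close>

definition discounted_mdp :: "real ^ 's::finite ^ ('s \<times> 'a::finite) \<Rightarrow> real \<Rightarrow> bool" where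
  "discounted_mdp P \<gamma> \<longleftrightarrow> (\<forall>s a. P $ (s, a) \<in> prob_simplex) \<and> 0 < \<gamma> \<and> \<gamma> < 1"

definition bellman ::
  "real ^ 's::finite ^ ('s \<times> 'a::finite) \<Rightarrow> real ^ ('s \<times> 'a) \<Rightarrow> real
     \<Rightarrow> real ^ ('s \<times> 'a) \<Rightarrow> real ^ ('s \<times> 'a)" where
  "bellman P R \<gamma> Q =
     vec_lambda (\<lambda>(s, a). R $ (s, a) + \<gamma> * (\<Sum>s'\<in>UNIV. P $ (s, a) $ s' * (MAX a'. Q $ (s', a'))))"

text \<open>The description is proper for every discounted MDP: see \<open>bellman_ex1_fixpoint\<close> below.\<close>

definition optimal_Q ::
  "real ^ 's::finite ^ ('s \<times> 'a::finite) \<Rightarrow> real ^ ('s \<times> 'a) \<Rightarrow> real \<Rightarrow> real ^ ('s \<times> 'a)" where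
  "optimal_Q P R \<gamma> = (THE Q. bellman P R \<gamma> Q = Q)"

definition policy_matrix :: "('s \<Rightarrow> real ^ 'a) \<Rightarrow> real ^ ('s::finite \<times> 'a::finite) ^ 's" where
  "policy_matrix \<mu> = (\<chi> s. vec_lambda (\<lambda>(t, a). if t = s then \<mu> s $ a else 0))"

definition closed_loop_matrix ::
  "real ^ 's::finite ^ ('s \<times> 'a::finite) \<Rightarrow> real \<Rightarrow> ('s \<Rightarrow> real ^ 'a)
     \<Rightarrow> real ^ ('s \<times> 'a) ^ ('s \<times> 'a)" where
  "closed_loop_matrix P \<gamma> \<mu> = \<gamma> *\<^sub>R (P ** policy_matrix \<mu>)"

lemma policy_matrix_mult_nth:
  "(policy_matrix \<mu> *v Q) $ s = (\<Sum>a\<in>UNIV. \<mu> s $ a * Q $ (s, a))"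
proof -
  have "(policy_matrix \<mu> *v Q) $ s =
      (\<Sum>(t, a)\<in>UNIV \<times> UNIV. (if t = s then \<mu> s $ a else 0) * Q $ (t, a))"
    by (simp add: policy_matrix_def matrix_vector_mult_def split_beta)
  also have "\<dots> = (\<Sum>t\<in>UNIV. \<Sum>a\<in>UNIV. if t = s then \<mu> s $ a * Q $ (s, a) else 0)"
    by (subst sum.cartesian_product [symmetric]) (intro sum.cong, auto)
  also have "\<dots> = (\<Sum>t\<in>UNIV. if t = s then \<Sum>a\<in>UNIV. \<mu> s $ a * Q $ (s, a) else 0)"
    by (intro sum.cong) auto
  finally show ?thesis by simp
qed

lemma bellman_contraction:
  assumes "discounted_mdp P \<gamma>"
  shows "infnorm (bellman P R \<gamma> x - bellman P R \<gamma> y) \<le> \<gamma> * infnorm (x - y)"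
proof -
  let ?d = "infnorm (x - y)"
  have g: "0 < \<gamma>" and P0: "0 \<le> P $ i $ s" and P1: "(\<Sum>s\<in>UNIV. P $ i $ s) = 1" for i s
    using assms by (cases i; auto simp: discounted_mdp_def prob_simplex_def)+
  have le: "(MAX a. u $ (s, a)) \<le> (MAX a. v $ (s, a)) + infnorm (u - v)"
    for s and u v :: "real ^ ('a \<times> 'b)"
  proof (subst Max_le_iff, simp, simp, clarsimp)
    fix a
    have "\<bar>(u - v) $ (s, a)\<bar> \<le> infnorm (u - v)" by (rule component_le_infnorm_cart)
    moreover have "v $ (s, a) \<le> (MAX a. v $ (s, a))" by (intro Max_ge) auto
    ultimately show "u $ (s, a) \<le> (MAX a. v $ (s, a)) + infnorm (u - v)"
      unfolding vector_minus_component by linarith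
  qed
  have M: "\<bar>(MAX a. x $ (s, a)) - (MAX a. y $ (s, a))\<bar> \<le> ?d" for s
    using le[of x s y] le[of y s x] infnorm_sub[of x y] by linarith
  have "\<bar>(bellman P R \<gamma> x - bellman P R \<gamma> y) $ i\<bar> \<le> \<gamma> * ?d" for i
  proof -
    have "(bellman P R \<gamma> x - bellman P R \<gamma> y) $ i
        = \<gamma> * (\<Sum>s\<in>UNIV. P $ i $ s * ((MAX a. x $ (s, a)) - (MAX a. y $ (s, a))))"
      by (simp add: bellman_def split_beta right_diff_distrib sum_subtractf)
    moreover have "\<bar>\<Sum>s\<in>UNIV. P $ i $ s * ((MAX a. x $ (s, a)) - (MAX a. y $ (s, a)))\<bar>
        \<le> (\<Sum>s\<in>UNIV. P $ i $ s * ?d)"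
      by (rule order_trans[OF sum_abs]) (auto intro!: sum_mono mult_left_mono M simp: abs_mult P0)
    moreover have "\<dots> = ?d" by (simp add: sum_distrib_right [symmetric] P1)
    ultimately show ?thesis using g by (simp add: abs_mult)
  qed
  then show ?thesis
    unfolding infnorm_cart by (intro cSup_least) auto
qed

lemma bellman_ex1_fixpoint:
  assumes "discounted_mdp P \<gamma>"
  shows "\<exists>!Q. bellman P R \<gamma> Q = Q"
proof -
  let ?F = "bellman P R \<gamma>"
  have g: "0 < \<gamma>" "\<gamma> < 1" using assms by (auto simp: discounted_mdp_def)
  have it: "infnorm ((?F ^^ m) x - (?F ^^ m) y) \<le> \<gamma> ^ m * infnorm (x - y)" for m x y
  proof (induction m)
    case (Suc m)
    have "infnorm ((?F ^^ Suc m) x - (?F ^^ Suc m) y)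
        \<le> \<gamma> * infnorm ((?F ^^ m) x - (?F ^^ m) y)"
      using bellman_contraction[OF assms] by simp
    also have "\<dots> \<le> \<gamma> * (\<gamma> ^ m * infnorm (x - y))"
      using Suc g by (intro mult_left_mono) auto
    finally show ?case by simp
  qed simp
  define C where "C = sqrt (DIM(real ^ ('a \<times> 'b)))"
  have C: "0 < C" by (simp add: C_def)
  obtain m where m: "\<gamma> ^ m < 1 / C"
    using real_arch_pow_inv[of "1 / C" \<gamma>] g C by auto
  have "\<exists>!x. (?F ^^ m) x = x"
  proof (rule banach_fix_type)
    show "0 \<le> C * \<gamma> ^ m" "C * \<gamma> ^ m < 1"
      using m C g by (auto simp: field_simps)
    show "\<forall>x y. dist ((?F ^^ m) x) ((?F ^^ m) y) \<le> C * \<gamma> ^ m * dist x y"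
    proof (intro allI)
      fix x y
      have "dist ((?F ^^ m) x) ((?F ^^ m) y) \<le> C * infnorm ((?F ^^ m) x - (?F ^^ m) y)"
        unfolding dist_norm C_def by (rule norm_le_infnorm)
      also have "\<dots> \<le> C * (\<gamma> ^ m * infnorm (x - y))"
        using it C by (intro mult_left_mono) auto
      also have "\<dots> \<le> C * (\<gamma> ^ m * norm (x - y))"
        using infnorm_le_norm C g by (intro mult_left_mono) auto
      finally show "dist ((?F ^^ m) x) ((?F ^^ m) y) \<le> C * \<gamma> ^ m * dist x y"
        by (simp add: dist_norm)
    qed
  qed
  then obtain x where x: "(?F ^^ m) x = x" and u: "\<And>y. (?F ^^ m) y = y \<Longrightarrow> y = x" by blast
  have "(?F ^^ m) (?F x) = ?F x" using x by (metis funpow_swap1)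
  then have "?F x = x" by (rule u)
  moreover have "y = x" if "?F y = y" for y
  proof (rule u)
    show "(?F ^^ m) y = y" using that by (induction m) auto
  qed
  ultimately show ?thesis by blast
qed

end

theory Submission imports Defs begin

text \<open>
  A difference of maxima \<open>max u - max v\<close> lies between the values of \<open>u - v\<close> at a maximiser of
  \<open>v\<close> and at a maximiser of \<open>u\<close>, hence is an average of \<open>u - v\<close>. Averaging weights for
  \<open>Q\<^sub>k\<close> against the fixed point \<open>Q\<^sup>*\<close>, chosen state by state, form the required policy.
\<close>

lemma Max_diff_eq_average:
  fixes u v :: "real ^ 'a::finite"
  shows "\<exists>p\<in>prob_simplex. (MAX a. u $ a) - (MAX a. v $ a) = (\<Sum>a\<in>UNIV. p $ a * (u $ a - v $ a))"
proof -
  have attained: "\<exists>a. (MAX a. w $ a) = w $ a" for w :: "real ^ 'a"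
  proof -
    have "(MAX a. w $ a) \<in> range (($) w)"
      by (intro Max_in) auto
    then show ?thesis by blast
  qed
  have ge: "w $ a \<le> (MAX a. w $ a)" for w :: "real ^ 'a" and a
    by (intro Max_ge) auto
  obtain a b where a: "(MAX a. u $ a) = u $ a" and b: "(MAX a. v $ a) = v $ b"
    using attained[of u] attained[of v] by blast
  \<comment> \<open>Maximality gives \<open>u $ b \<le> u $ a\<close> and
    \<open>v $ a \<le> v $ b\<close>; subtract \<open>v $ b\<close> from the first and the second
    from \<open>u $ a\<close>.\<close>
  have "u $ a - v $ b \<in> closed_segment ((u - v) $ b) ((u - v) $ a)"
    using ge[of v a] ge[of u b] a b by (auto simp: closed_segment_eq_real_ivl)
  then obtain t where t: "0 \<le> t" "t \<le> 1"
    and eq: "u $ a - v $ b = (1 - t) * (u - v) $ b + t * (u - v) $ a"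
    by (auto simp: in_segment)
  define p :: "real ^ 'a" where "p = (1 - t) *\<^sub>R axis b 1 + t *\<^sub>R axis a 1"
  \<comment> \<open>Used twice: the all-ones vector gives total mass 1, and \<open>u - v\<close>
    gives the required average. If \<open>a = b\<close>, the two masses simply add up.\<close>
  have sum_p: "(\<Sum>i\<in>UNIV. p $ i * w $ i) = (1 - t) * w $ b + t * w $ a" for w :: "real ^ 'a"
  proof -
    have "(\<Sum>i\<in>UNIV. p $ i * w $ i) = p \<bullet> w"
      by (simp add: inner_vec_def)
    then show ?thesis
      by (simp add: p_def inner_add_left inner_axis')
  qed
  have "p \<in> prob_simplex"
    using t sum_p[of 1] by (auto simp: prob_simplex_def p_def axis_def)
  moreover have "(MAX a. u $ a) - (MAX a. v $ a) = (\<Sum>i\<in>UNIV. p $ i * (u $ i - v $ i))"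
    using sum_p[of "u - v"] eq a b by simp
  ultimately show ?thesis by blast
qed

text \<open>Rewards cancel, leaving \<open>\<gamma> P\<close> applied to the state-wise differences
  of maxima. The policy depends on \<open>x\<close> and \<open>y\<close>, so this is not linearity
  of the operator.\<close>

lemma bellman_diff_eq_closed_loop:
  fixes P :: "real ^ 's::finite ^ ('s \<times> 'a::finite)"
  shows "\<exists>\<mu>. stochastic_policy \<mu> \<and>
    bellman P R \<gamma> x - bellman P R \<gamma> y = closed_loop_matrix P \<gamma> \<mu> *v (x - y)"
proof -
  have "\<forall>s. \<exists>p. p \<in> prob_simplex \<and> (MAX a. x $ (s, a)) - (MAX a. y $ (s, a)) =
      (\<Sum>a\<in>UNIV. p $ a * (x $ (s, a) - y $ (s, a)))"
  proof
    fix s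
    show "\<exists>p. p \<in> prob_simplex \<and> (MAX a. x $ (s, a)) - (MAX a. y $ (s, a)) =
        (\<Sum>a\<in>UNIV. p $ a * (x $ (s, a) - y $ (s, a)))"
      using Max_diff_eq_average[of "\<chi> a. x $ (s, a)" "\<chi> a. y $ (s, a)"] by (simp add: Bex_def)
  qed
  \<comment> \<open>The weights depend only on the successor state, so one policy serves all rows of
    \<open>P\<close>.\<close>
  from choice[OF this] obtain \<mu> :: "'s \<Rightarrow> real ^ 'a" where \<mu>: "\<And>s. \<mu> s \<in> prob_simplex"
    and eq: "\<And>s. (MAX a. x $ (s, a)) - (MAX a. y $ (s, a)) =
      (\<Sum>a\<in>UNIV. \<mu> s $ a * (x $ (s, a) - y $ (s, a)))"
    by blast
  have max_diff: "(policy_matrix \<mu> *v (x - y)) $ s = (MAX a. x $ (s, a)) - (MAX a. y $ (s, a))" for s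
    by (simp add: policy_matrix_mult_nth eq)
  have "closed_loop_matrix P \<gamma> \<mu> *v (x - y) = \<gamma> *\<^sub>R (P *v (policy_matrix \<mu> *v (x - y)))"
    by (simp add: closed_loop_matrix_def scaleR_matrix_vector_assoc matrix_vector_mul_assoc)
  also have "\<dots> = bellman P R \<gamma> x - bellman P R \<gamma> y"
    unfolding vec_eq_iff
    \<comment> \<open>Only the product with \<open>P\<close> is expanded; the inner product stays
      folded so that \<open>max_diff\<close> can rewrite it.\<close>
    by (simp add: matrix_vector_mult_def[of P] max_diff bellman_def split_beta
        right_diff_distrib sum_subtractf)
  finally show ?thesis
    using \<mu> unfolding stochastic_policy_def by metis
qed

theorem lemma5:
  fixes P :: "real ^ 's::finite ^ ('s \<times> 'a::finite)"
    and R :: "real ^ ('s \<times> 'a)"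
    and \<gamma> :: real
    and Q e :: "nat \<Rightarrow> real ^ ('s \<times> 'a)"
  assumes "discounted_mdp P \<gamma>"
    and "\<And>k. Q (k + 1) = bellman P R \<gamma> (Q k)"
    and "\<And>k. e k = Q k - optimal_Q P R \<gamma>"
  shows "\<forall>k. \<exists>\<mu> :: 's \<Rightarrow> real ^ 'a.
    stochastic_policy \<mu> \<and> e (k + 1) = closed_loop_matrix P \<gamma> \<mu> *v e k"
proof
  fix k
  \<comment> \<open>Unique existence of the fixed point makes the description in
    \<open>optimal_Q\<close> proper; the error then becomes a difference of two Bellman
    images.\<close>
  have "bellman P R \<gamma> (optimal_Q P R \<gamma>) = optimal_Q P R \<gamma>"
    unfolding optimal_Q_def by (rule theI'[OF bellman_ex1_fixpoint[OF assms(1)]])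
  then have "e (k + 1) = bellman P R \<gamma> (Q k) - bellman P R \<gamma> (optimal_Q P R \<gamma>)"
    by (simp only: assms(2,3))
  then show "\<exists>\<mu> :: 's \<Rightarrow> real ^ 'a.
      stochastic_policy \<mu> \<and> e (k + 1) = closed_loop_matrix P \<gamma> \<mu> *v e k"
    using bellman_diff_eq_closed_loop[of P R \<gamma> "Q k" "optimal_Q P R \<gamma>"]
    by (simp only: assms(3))
qed

end
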